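(* Let $n\geq 1$ be an integer, let $\eta,b,c,v,\mu,\theta_0\in\mathbb{R}$ with $v\neq 0$, and let $I\subseteq\mathbb{R}\setminus\{0\}$ be an open interval on which $x^{n-1}(1+2\eta x^n)>0$. Suppose that $bv^6+c^2=0$. Then the function $$r(x)=\frac{v}{\sqrt{x^{n-1}(1+2\eta x^{n})}}$$ is a solution on $I$ of $$r''(x)=\frac{c^2}{r(x)^3}+\left(\frac{n^2-1}{4x^2}+\frac{3\eta^2n^2x^{2n-2}}{(1+2\eta x^n)^2}\right)r(x)+b\,x^{3n-3}(1+2\eta x^n)^3\,r(x)^3 .$$ The corresponding function $$\psi(x,t)=v\,\frac{\exp\left(\mathrm{i}\left(\frac{c\,x^n(1+\eta x^n)}{n v^2}+\theta_0-\mu t\right)\right)}{\sqrt{x^{n-1}(1+2\eta x^{n})}},\qquad x\in I,\ t\in\mathbb{R},$$ is a solution of the Gross-Pitaevskii equation $$\mathrm{i}\,\frac{\partial\psi}{\partial t}=-\frac12\frac{\partial^2\psi}{\partial x^2}+V(x)\psi+g(x)|\psi|^2\psi$$ with $V$ and $g$ determined by $$2(V(x)-\mu)=\frac{n^2-1}{4x^2}+\frac{3\eta^2n^2x^{2n-2}}{(1+2\eta x^n)^2},\qquad 2g(x)=b\,x^{3n-3}(1+2\eta x^n)^3 .$$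
   Context: Here $\mathrm{i}$ is the imaginary unit. The correspondence between $r$ and $\psi$ is $\psi(x,t)=r(x)e^{\mathrm{i}(\theta(x)-\mu t)}$ with $\theta$ real-valued and $r^2\theta'=c$. *)

theory Defs
  imports "HOL-Analysis.Analysis"
begin

definition solves_ode2 :: "(real \<Rightarrow> real \<Rightarrow> real) \<Rightarrow> real set \<Rightarrow> (real \<Rightarrow> real) \<Rightarrow> bool" where
  "solves_ode2 F I r \<longleftrightarrow>
     (\<exists>r'. \<forall>x\<in>I. (r has_real_derivative r' x) (at x) \<and>
                 (r' has_real_derivative F x (r x)) (at x))"

text \<open>Classical solutions: every derivative occurring in the equation exists and is jointly
  continuous in \<open>(x, t)\<close>.\<close>

definition gross_pitaevskii_solution ::
  "(real \<Rightarrow> real) \<Rightarrow> (real \<Rightarrow> real) \<Rightarrow> real set \<Rightarrow> (real \<Rightarrow> real \<Rightarrow> complex) \<Rightarrow> bool" where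
  "gross_pitaevskii_solution V g I \<psi> \<longleftrightarrow>
     (\<exists>\<psi>t \<psi>x \<psi>xx :: real \<Rightarrow> real \<Rightarrow> complex.
        continuous_on (I \<times> UNIV) (\<lambda>(x, t). \<psi> x t) \<and>
        continuous_on (I \<times> UNIV) (\<lambda>(x, t). \<psi>t x t) \<and>
        continuous_on (I \<times> UNIV) (\<lambda>(x, t). \<psi>x x t) \<and>
        continuous_on (I \<times> UNIV) (\<lambda>(x, t). \<psi>xx x t) \<and>
        (\<forall>x\<in>I. \<forall>t.
           ((\<lambda>s. \<psi> x s) has_vector_derivative \<psi>t x t) (at t) \<and>
           ((\<lambda>y. \<psi> y t) has_vector_derivative \<psi>x x t) (at x) \<and>
           ((\<lambda>y. \<psi>x y t) has_vector_derivative \<psi>xx x t) (at x) \<and>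
           \<i> * \<psi>t x t =
             - (1 / 2) * \<psi>xx x t + complex_of_real (V x) * \<psi> x t
             + complex_of_real (g x * (cmod (\<psi> x t))\<^sup>2) * \<psi> x t))"

text \<open>The correspondence \<open>\<psi>(x,t) = r(x) exp(i (\<theta>(x) - \<mu> t))\<close> with \<open>r\<^sup>2 \<theta>' = c\<close>.\<close>

definition corresponds ::
  "real \<Rightarrow> real \<Rightarrow> real set \<Rightarrow> (real \<Rightarrow> real) \<Rightarrow> (real \<Rightarrow> real \<Rightarrow> complex) \<Rightarrow> bool" where
  "corresponds c \<mu> I r \<psi> \<longleftrightarrow>
     (\<exists>\<theta> \<theta>' :: real \<Rightarrow> real. \<forall>x\<in>I.
        (\<theta> has_real_derivative \<theta>' x) (at x) \<and> (r x)\<^sup>2 * \<theta>' x = c \<and>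
        (\<forall>t. \<psi> x t = complex_of_real (r x) * exp (\<i> * complex_of_real (\<theta> x - \<mu> * t))))"

end

theory Submission imports Defs begin

text \<open>Write \<open>r = v P powr (-1/2)\<close> with \<open>P = x ^ (n - 1) * (1 + 2 * \<eta> * x ^ n)\<close>, and let
  \<open>L = P' / P\<close>. Then \<open>r' = - L r / 2\<close> and \<open>r'' = (L\<^sup>2 / 4 - L' / 2) r\<close>, which is the linear part of the
  equation; the two nonlinear terms \<open>c\<^sup>2 / r\<^sup>3\<close> and \<open>b P\<^sup>3 r\<^sup>3\<close> cancel because \<open>b v\<^sup>6 + c\<^sup>2 = 0\<close>.
  The wave equation follows by the Madelung substitution: since \<open>r\<^sup>2 \<theta>' = c\<close>, the imaginary part
  \<open>2 r' \<theta>' + r \<theta>''\<close> of \<open>\<psi>\<^sub>x\<^sub>x exp (- \<i> (\<theta> - \<mu> t))\<close> vanishes.\<close>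

lemma has_vector_derivative_cis_real:
  fixes f :: "real \<Rightarrow> real"
  assumes "(f has_real_derivative f') (at x)"
  shows "((\<lambda>y. exp (\<i> * complex_of_real (f y))) has_vector_derivative
            \<i> * complex_of_real f' * exp (\<i> * complex_of_real (f x))) (at x)"
proof -
  have "((\<lambda>y. \<i> * complex_of_real (f y)) has_vector_derivative \<i> * complex_of_real f') (at x)"
    using assms by (intro has_vector_derivative_mult_right has_vector_derivative_of_real)
      (simp add: has_real_derivative_iff_has_vector_derivative)
  from field_vector_diff_chain_at[OF this DERIV_exp]
  show ?thesis by (simp add: o_def)
qed

text \<open>With the phase factored out, differentiation acts on the amplitude alone, as
  \<open>h\<close> to \<open>h' + i f' h\<close>. This gives both x-derivatives and the t-derivative
  of the wave function.\<close>

lemma has_vector_derivative_mult_cis_real: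
  fixes f :: "real \<Rightarrow> real" and h :: "real \<Rightarrow> complex"
  assumes "(h has_vector_derivative h') (at x)" and "(f has_real_derivative f') (at x)"
  shows "((\<lambda>y. h y * exp (\<i> * complex_of_real (f y))) has_vector_derivative
            (h' + \<i> * complex_of_real f' * h x) * exp (\<i> * complex_of_real (f x))) (at x)"
  using has_vector_derivative_mult[OF assms(1) has_vector_derivative_cis_real[OF assms(2)]]
  by (simp add: algebra_simps)

text \<open>Dividing by \<open>x\<close> avoids the truncated exponent \<open>m - 1\<close>; at
  \<open>m = 0\<close> both sides are 0.\<close>

lemma has_real_derivative_power_nonzero:
  fixes x :: real
  assumes "x \<noteq> 0"
  shows "((\<lambda>y. y ^ m) has_real_derivative real m * x ^ m / x) (at x)"
  using DERIV_pow[of m x] assms by (cases m) auto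

text \<open>Here \<open>L\<close> is the logarithmic derivative of \<open>P\<close>, so the power
  -1/2 merely multiplies it by -1/2.\<close>

lemma has_real_derivative_inverse_sqrt:
  fixes P :: "real \<Rightarrow> real"
  assumes "(P has_real_derivative P x * L) (at x)" and "P x > 0"
  shows "((\<lambda>y. v / sqrt (P y)) has_real_derivative - (v / sqrt (P x)) * L / 2) (at x)"
proof -
  have s: "((\<lambda>y. sqrt (P y)) has_real_derivative sqrt (P x) * L / 2) (at x)"
    by (rule DERIV_cong[OF DERIV_chain2[OF DERIV_real_sqrt[OF assms(2)] assms(1)]])
      (use assms(2) in \<open>simp add: field_simps\<close>)
  show ?thesis
    by (rule DERIV_cong[OF DERIV_divide[OF DERIV_const s]])
      (use assms(2) in \<open>auto simp: field_simps\<close>)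
qed

text \<open>The term \<open>r \<theta>'^2 = c^2 / r^3\<close> produced by the phase cancels the
  first term of the equation for \<open>r\<close>, and what remains is the stationary wave equation.
  Continuity of \<open>V\<close> and \<open>g\<close> gives joint continuity of the second
  x-derivative.\<close>

lemma gross_pitaevskii_solution_if_corresponds:
  assumes "open I" and nz: "\<And>x. x \<in> I \<Longrightarrow> r x \<noteq> 0"
    and V: "continuous_on I V" and g: "continuous_on I g"
    and "solves_ode2 (\<lambda>x y. c\<^sup>2 / y ^ 3 + 2 * (V x - \<mu>) * y + 2 * g x * y ^ 3) I r"
    and "corresponds c \<mu> I r \<psi>"
  shows "gross_pitaevskii_solution V g I \<psi>"
proof -
  from assms(5) obtain r' where
    r: "\<And>x. x \<in> I \<Longrightarrow> (r has_real_derivative r' x) (at x)" and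
    r': "\<And>x. x \<in> I \<Longrightarrow> (r' has_real_derivative
           c\<^sup>2 / r x ^ 3 + 2 * (V x - \<mu>) * r x + 2 * g x * r x ^ 3) (at x)"
    unfolding solves_ode2_def by blast
  from assms(6) obtain \<theta> \<theta>' where
    \<theta>0: "\<And>x. x \<in> I \<Longrightarrow> (\<theta> has_real_derivative \<theta>' x) (at x)" and
    c: "\<And>x. x \<in> I \<Longrightarrow> (r x)\<^sup>2 * \<theta>' x = c" and
    \<psi>: "\<And>x t. x \<in> I \<Longrightarrow> \<psi> x t = complex_of_real (r x) * exp (\<i> * complex_of_real (\<theta> x - \<mu> * t))"
    unfolding corresponds_def by blast
  have \<theta>: "(\<theta> has_real_derivative c / (r x)\<^sup>2) (at x)" if "x \<in> I" for x
    using \<theta>0[OF that] c[OF that] nz[OF that] by (metis nonzero_mult_div_cancel_left power_not_zero)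
  \<comment> \<open>\<open>E\<close> is the common phase factor;
    \<open>A = r' + i r \<theta>'\<close> and the real \<open>B\<close> are the amplitudes of the
    first and second x-derivatives of \<open>\<psi>\<close>.\<close>
  define E where "E x t = exp (\<i> * complex_of_real (\<theta> x - \<mu> * t))" for x t
  define A where "A x = Complex (r' x) (c / r x)" for x
  define B where "B x = 2 * (V x - \<mu>) * r x + 2 * g x * r x ^ 3" for x
  have dr: "((\<lambda>y. complex_of_real (r y)) has_vector_derivative complex_of_real (r' x)) (at x)"
    if "x \<in> I" for x
    using r[OF that] by (intro has_vector_derivative_of_real)
      (simp add: has_real_derivative_iff_has_vector_derivative)
  have dA: "(A has_vector_derivative
      Complex (c\<^sup>2 / r x ^ 3 + B x) (- (c * r' x / (r x)\<^sup>2))) (at x)" if "x \<in> I" for x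
  proof -
    have "((\<lambda>y. c / r y) has_real_derivative - (c * r' x / (r x)\<^sup>2)) (at x)"
      using nz[OF that] by (auto intro!: derivative_eq_intros r[OF that] simp: power2_eq_square)
    moreover have "(r' has_real_derivative c\<^sup>2 / r x ^ 3 + B x) (at x)"
      using r'[OF that] by (simp add: B_def add.assoc)
    ultimately show ?thesis
      unfolding A_def has_vector_derivative_complex_iff
      by (simp add: has_real_derivative_iff_has_vector_derivative)
  qed
  have d\<theta>: "((\<lambda>y. \<theta> y - \<mu> * t) has_real_derivative c / (r x)\<^sup>2) (at x)" if "x \<in> I" for x t
    by (auto intro!: derivative_eq_intros \<theta>[OF that])
  have \<psi>x: "((\<lambda>y. \<psi> y t) has_vector_derivative A x * E x t) (at x)" if "x \<in> I" for x t
  proof -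
    have "((\<lambda>y. complex_of_real (r y) * E y t) has_vector_derivative A x * E x t) (at x)"
      using has_vector_derivative_mult_cis_real[OF dr[OF that] d\<theta>[OF that, of t]] nz[OF that]
      by (simp add: E_def A_def Complex_eq power2_eq_square)
    then show ?thesis
      by (rule has_vector_derivative_transform_within_open[OF _ \<open>open I\<close> that]) (simp add: \<psi> E_def)
  qed
  have \<psi>xx: "((\<lambda>y. A y * E y t) has_vector_derivative complex_of_real (B x) * E x t) (at x)"
    if "x \<in> I" for x t
  proof -
    \<comment> \<open>The real part loses \<open>c^2 / r^3\<close> to
      \<open>(c / r^2) (c / r)\<close>; in the imaginary part the two terms
      \<open>c r' / r^2\<close> cancel.\<close>
    have "Complex (c\<^sup>2 / r x ^ 3 + B x) (- (c * r' x / (r x)\<^sup>2))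
            + \<i> * complex_of_real (c / (r x)\<^sup>2) * A x = complex_of_real (B x)"
      using nz[OF that]
      by (simp add: complex_eq_iff A_def power2_eq_square power3_eq_cube)
    then show ?thesis
      using has_vector_derivative_mult_cis_real[OF dA[OF that] d\<theta>[OF that, of t]]
      by (simp add: E_def)
  qed
  have \<psi>t: "((\<lambda>s. \<psi> x s) has_vector_derivative - \<i> * complex_of_real (\<mu> * r x) * E x t) (at t)"
    if "x \<in> I" for x t
  proof -
    have "((\<lambda>s. \<theta> x - \<mu> * s) has_real_derivative - \<mu>) (at t)"
      by (auto intro!: derivative_eq_intros)
    from has_vector_derivative_mult_cis_real[OF has_vector_derivative_const[of "complex_of_real (r x)"] this]
    show ?thesis by (simp add: \<psi>[OF that] E_def mult_ac)
  qed
  have cr: "continuous_on I r" and c\<theta>: "continuous_on I \<theta>"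
    using r \<theta> by (meson DERIV_isCont continuous_at_imp_continuous_on)+
  have cA: "continuous_on I A"
    using dA by (meson has_vector_derivative_continuous continuous_at_imp_continuous_on)
  have cB: "continuous_on I B"
    unfolding B_def by (intro continuous_intros V g cr)
  have fst: "continuous_on (I \<times> UNIV) (\<lambda>p. f (fst p))" if "continuous_on I f"
    for f :: "real \<Rightarrow> 'a::topological_space"
    by (rule continuous_on_compose2[OF that continuous_on_fst[OF continuous_on_id]]) auto
  \<comment> \<open>All functions involved have the form \<open>a x * E x t\<close> on
    \<open>I\<close>, so joint continuity reduces to continuity of the amplitude in
    \<open>x\<close>.\<close>
  have joint: "continuous_on (I \<times> UNIV) (\<lambda>(x, t). a x * E x t)" if "continuous_on I a" for a
    unfolding E_def case_prod_unfold
    by (intro continuous_intros fst that c\<theta>)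
  \<comment> \<open>As \<open>|\<psi>| = |r|\<close>, dividing out the phase leaves
    \<open>\<mu> r = - B / 2 + V r + g r^3\<close>, the definition of \<open>B\<close>.\<close>
  have GP: "\<i> * (- \<i> * complex_of_real (\<mu> * r x) * E x t) =
             - (1 / 2) * (complex_of_real (B x) * E x t) + complex_of_real (V x) * \<psi> x t
             + complex_of_real (g x * (cmod (\<psi> x t))\<^sup>2) * \<psi> x t" if "x \<in> I" for x t
  proof -
    have "cmod (\<psi> x t) = \<bar>r x\<bar>"
      by (simp add: \<psi>[OF that] norm_mult)
    then show ?thesis
      by (simp add: \<psi>[OF that] E_def B_def algebra_simps power2_eq_square power3_eq_cube)
  qed
  have c\<psi>: "continuous_on (I \<times> UNIV) (\<lambda>(x, t). \<psi> x t)"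
    using joint[of "\<lambda>x. complex_of_real (r x)"] cr
    by (subst continuous_on_cong[OF refl, of _ _ "\<lambda>(x, t). complex_of_real (r x) * E x t"])
      (auto simp: \<psi> E_def intro: continuous_intros)
  show ?thesis
    unfolding gross_pitaevskii_solution_def
    by (rule exI[of _ "\<lambda>x t. - \<i> * complex_of_real (\<mu> * r x) * E x t"],
        rule exI[of _ "\<lambda>x t. A x * E x t"],
        rule exI[of _ "\<lambda>x t. complex_of_real (B x) * E x t"])
      (intro conjI ballI allI c\<psi> joint \<psi>x \<psi>xx \<psi>t GP continuous_intros cr cA cB)
qed

theorem mainTheorem2:
  fixes n :: nat and \<eta> b c v \<mu> \<theta>\<^sub>0 :: real and I :: "real set"
    and r V g :: "real \<Rightarrow> real" and \<psi> :: "real \<Rightarrow> real \<Rightarrow> complex"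
  assumes "n \<ge> 1" and "v \<noteq> 0"
    and "open I" and "is_interval I" and "I \<subseteq> UNIV - {0}"
    and "\<forall>x\<in>I. x ^ (n - 1) * (1 + 2 * \<eta> * x ^ n) > 0"
    and "b * v ^ 6 + c\<^sup>2 = 0"
    and "\<forall>x\<in>I. r x = v / sqrt (x ^ (n - 1) * (1 + 2 * \<eta> * x ^ n))"
    and "\<forall>x\<in>I. \<forall>t. \<psi> x t =
           complex_of_real v
           * exp (\<i> * complex_of_real
                        (c * x ^ n * (1 + \<eta> * x ^ n) / (real n * v\<^sup>2) + \<theta>\<^sub>0 - \<mu> * t))
           / complex_of_real (sqrt (x ^ (n - 1) * (1 + 2 * \<eta> * x ^ n)))"
    and "\<forall>x\<in>I. 2 * (V x - \<mu>) =
           ((real n)\<^sup>2 - 1) / (4 * x\<^sup>2)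
           + 3 * \<eta>\<^sup>2 * (real n)\<^sup>2 * x ^ (2 * n - 2) / (1 + 2 * \<eta> * x ^ n)\<^sup>2"
    and "\<forall>x\<in>I. 2 * g x = b * x ^ (3 * n - 3) * (1 + 2 * \<eta> * x ^ n) ^ 3"
  shows "solves_ode2
           (\<lambda>x y. c\<^sup>2 / y ^ 3
              + (((real n)\<^sup>2 - 1) / (4 * x\<^sup>2)
                 + 3 * \<eta>\<^sup>2 * (real n)\<^sup>2 * x ^ (2 * n - 2) / (1 + 2 * \<eta> * x ^ n)\<^sup>2) * y
              + b * x ^ (3 * n - 3) * (1 + 2 * \<eta> * x ^ n) ^ 3 * y ^ 3)
           I r
         \<and> corresponds c \<mu> I r \<psi>
         \<and> gross_pitaevskii_solution V g I \<psi>"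
proof -
  define w where "w x = 1 + 2 * \<eta> * x ^ n" for x
  define P where "P x = x ^ (n - 1) * w x" for x
  \<comment> \<open>\<open>q = w' / w\<close>, and the logarithmic derivative
    \<open>L = P' / P\<close> is the sum of those of the two factors of \<open>P\<close>.\<close>
  define q where "q x = 2 * \<eta> * real n * x ^ (n - 1) / w x" for x
  define L where "L x = (real n - 1) / x + q x" for x
  define Q where "Q x = ((real n)\<^sup>2 - 1) / (4 * x\<^sup>2)
      + 3 * \<eta>\<^sup>2 * (real n)\<^sup>2 * x ^ (2 * n - 2) / (w x)\<^sup>2" for x
  define G where "G x = b * x ^ (3 * n - 3) * w x ^ 3" for x
  obtain m where n: "n = Suc m"
    using \<open>n \<ge> 1\<close> by (cases n) auto
  have x0: "x \<noteq> 0" and Ppos: "P x > 0" and w0: "w x \<noteq> 0" if "x \<in> I" for x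
    using that assms(5,6) by (force simp: P_def w_def)+
  have r: "r x = v / sqrt (P x)" if "x \<in> I" for x
    using that assms(8) by (simp add: P_def w_def)
  have r0: "r x \<noteq> 0" if "x \<in> I" for x
    using r[OF that] Ppos[OF that] \<open>v \<noteq> 0\<close> by simp
  have r2: "(r x)\<^sup>2 = v\<^sup>2 / P x" if "x \<in> I" for x
    using r[OF that] Ppos[OF that] by (simp add: power_divide)
  have VQ: "2 * (V x - \<mu>) = Q x" and gG: "2 * g x = G x" if "x \<in> I" for x
    using that assms(10,11) by (simp_all add: Q_def G_def w_def)

  have dw: "(w has_real_derivative w x * q x) (at x)" if "x \<in> I" for x
    using w0[OF that] unfolding w_def q_def
    by (auto intro!: derivative_eq_intros)
  have dP: "(P has_real_derivative P x * L x) (at x)" if "x \<in> I" for x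
    using DERIV_mult[OF has_real_derivative_power_nonzero[OF x0[OF that]] dw[OF that], of "n - 1"]
      x0[OF that] by (simp add: P_def [abs_def] L_def n field_simps)
  \<comment> \<open>The logarithmic derivative of \<open>q\<close> is \<open>(n - 1) / x\<close>
    from the power minus \<open>q\<close> from \<open>1 / w\<close>. Thus further derivatives stay
    polynomial in \<open>1 / x\<close> and \<open>q\<close>.\<close>
  have dq: "(q has_real_derivative q x * ((real n - 1) / x - q x)) (at x)" if "x \<in> I" for x
    unfolding q_def
    by (rule DERIV_cong[OF DERIV_divide[OF
          DERIV_cmult[OF has_real_derivative_power_nonzero[OF x0[OF that]]] dw[OF that] w0[OF that]]])
      (use x0[OF that] w0[OF that] in \<open>simp add: q_def n field_simps\<close>)
  have dL: "(L has_real_derivative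
      - (real n - 1) / x\<^sup>2 + q x * ((real n - 1) / x - q x)) (at x)" if "x \<in> I" for x
    unfolding L_def using x0[OF that]
    by (auto intro!: derivative_eq_intros dq[OF that] simp: power2_eq_square)
  have dr: "(r has_real_derivative - r x * L x / 2) (at x)" if "x \<in> I" for x
    using has_real_derivative_inverse_sqrt[OF dP[OF that] Ppos[OF that], of v] r[OF that]
    by (auto intro: has_field_derivative_transform_within_open[OF _ \<open>open I\<close> that] simp: r)
  \<comment> \<open>The mixed terms \<open>q (n - 1) / x\<close> cancel. The rest is
    \<open>((n - 1)^2 + 2 (n - 1)) / (4 x^2) = (n^2 - 1) / (4 x^2)\<close> and
    \<open>q^2 / 4 + q^2 / 2\<close>.\<close>
  have Q: "(L x)\<^sup>2 / 4 - (- (real n - 1) / x\<^sup>2 + q x * ((real n - 1) / x - q x)) / 2 = Q x"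
    if "x \<in> I" for x
  proof -
    have "Q x = ((real n)\<^sup>2 - 1) / (4 * x\<^sup>2) + 3 / 4 * (q x)\<^sup>2"
      unfolding Q_def q_def n by (simp add: power_divide power_mult_distrib power_mult mult.commute
          flip: power_mult)
    then show ?thesis
      using x0[OF that] by (simp only: L_def) (simp add: field_simps power2_eq_square)
  qed
  \<comment> \<open>Since \<open>G = b P^3\<close> and \<open>r^6 P^3 = v^6\<close>, multiplying by
    \<open>r^3\<close> turns the claim into \<open>c^2 + b v^6 = 0\<close>.\<close>
  have cancel: "c\<^sup>2 / r x ^ 3 + G x * r x ^ 3 = 0" if "x \<in> I" for x
  proof -
    have "x ^ (3 * n - 3) = (x ^ (n - 1)) ^ 3"
      by (simp add: n mult.commute flip: power_mult)
    then have "G x = b * P x ^ 3"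
      by (simp add: G_def P_def power_mult_distrib)
    moreover have "(r x) ^ 6 * P x ^ 3 = v ^ 6"
      using arg_cong[OF r2[OF that], of "\<lambda>y. y ^ 3"] Ppos[OF that]
      by (simp add: power_divide field_simps flip: power_mult)
    ultimately have "c\<^sup>2 + G x * r x ^ 6 = 0"
      using assms(7) by (simp add: mult_ac)
    then show ?thesis
      using r0[OF that] by (simp add: field_simps flip: power_add)
  qed
  have d2r: "((\<lambda>y. - r y * L y / 2) has_real_derivative
      c\<^sup>2 / r x ^ 3 + Q x * r x + G x * r x ^ 3) (at x)" if "x \<in> I" for x
  proof -
    have "((\<lambda>y. - r y * L y / 2) has_real_derivative Q x * r x) (at x)"
      unfolding Q[OF that, symmetric]
      by (auto intro!: derivative_eq_intros dr[OF that] dL[OF that]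
          simp: field_simps power2_eq_square)
    moreover have "Q x * r x = c\<^sup>2 / r x ^ 3 + Q x * r x + G x * r x ^ 3"
      using cancel[OF that] by simp
    ultimately show ?thesis by (rule DERIV_cong)
  qed
  \<comment> \<open>Kept unfolded so that \<open>Q\<close> and \<open>G\<close> can be exchanged for
    \<open>V\<close> and \<open>g\<close> under the quantifier: these identities hold only on
    \<open>I\<close>.\<close>
  have ode': "\<exists>r'. \<forall>x\<in>I. (r has_real_derivative r' x) (at x) \<and>
       (r' has_real_derivative c\<^sup>2 / r x ^ 3 + Q x * r x + G x * r x ^ 3) (at x)"
    by (rule exI[of _ "\<lambda>y. - r y * L y / 2"]) (intro ballI conjI dr d2r)
  then have ode: "solves_ode2 (\<lambda>x y. c\<^sup>2 / y ^ 3 + Q x * y + G x * y ^ 3) I r"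
    by (simp add: solves_ode2_def)
  have ode_Vg: "solves_ode2 (\<lambda>x y. c\<^sup>2 / y ^ 3 + 2 * (V x - \<mu>) * y + 2 * g x * y ^ 3) I r"
    using ode' unfolding solves_ode2_def by (simp only: VQ gG cong: ball_cong)

  \<comment> \<open>An antiderivative of \<open>c / r^2 = c P / v^2\<close>:
    \<open>P = x^(n-1) + 2 \<eta> x^(2n-1)\<close> integrates to
    \<open>x^n (1 + \<eta> x^n) / n\<close>, with \<open>\<theta>\<^sub>0\<close> as integration
    constant.\<close>
  define \<theta> where "\<theta> x = c * x ^ n * (1 + \<eta> * x ^ n) / (real n * v\<^sup>2) + \<theta>\<^sub>0" for x
  have d\<theta>: "(\<theta> has_real_derivative c * P x / v\<^sup>2) (at x)" for x
    unfolding \<theta>_def P_def w_def using \<open>n \<ge> 1\<close> \<open>v \<noteq> 0\<close>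
    by (auto intro!: derivative_eq_intros simp: field_simps)
  have corr: "corresponds c \<mu> I r \<psi>"
    unfolding corresponds_def
  proof (intro exI ballI conjI allI)
    fix x t assume x: "x \<in> I"
    show "(\<theta> has_real_derivative c * P x / v\<^sup>2) (at x)"
      by (fact d\<theta>)
    show "(r x)\<^sup>2 * (c * P x / v\<^sup>2) = c"
      using r2[OF x] Ppos[OF x] \<open>v \<noteq> 0\<close> by simp
    show "\<psi> x t = complex_of_real (r x) * exp (\<i> * complex_of_real (\<theta> x - \<mu> * t))"
      using x assms(9) r[OF x] by (simp add: \<theta>_def P_def w_def)
  qed

  \<comment> \<open>\<open>V\<close> and \<open>g\<close> are prescribed only on \<open>I\<close>,
    so their continuity is transferred from \<open>\<mu> + Q / 2\<close> and \<open>G / 2\<close>;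
    the denominators \<open>x\<close> and \<open>w\<close> of \<open>Q\<close> do not vanish
    there.\<close>
  have cw: "continuous_on S w" for S
    unfolding w_def by (intro continuous_intros)
  have "continuous_on I (\<lambda>x. \<mu> + Q x / 2)"
    unfolding Q_def using x0 w0 by (intro continuous_intros cw) auto
  then have V: "continuous_on I V"
    using VQ by (subst continuous_on_cong[OF refl, of _ _ "\<lambda>x. \<mu> + Q x / 2"]) (auto simp: field_simps)
  have "continuous_on I (\<lambda>x. G x / 2)"
    unfolding G_def by (intro continuous_intros cw) auto
  then have g: "continuous_on I g"
    using gG by (subst continuous_on_cong[OF refl, of _ _ "\<lambda>x. G x / 2"]) (auto simp: field_simps)
  have "gross_pitaevskii_solution V g I \<psi>"
    using \<open>open I\<close> r0 V g ode_Vg corr by (rule gross_pitaevskii_solution_if_corresponds)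
  then show ?thesis
    using ode corr by (simp add: Q_def G_def w_def)
qed

end
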